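(* If $t>1$ is an integer and $G=K_2\bigtriangledown tK_2$, then $G$ is $Q$-exact, but $G$ is neither $L$-exact nor $A$-exact.
   Context: All graphs are finite, simple and unweighted. $tK_2$ is the disjoint union of $t$ copies of the complete graph $K_2$. The join $G\bigtriangledown H$ of two graphs on disjoint vertex sets is obtained from their disjoint union by adding all edges $uv$ with $u\in V(G)$, $v\in V(H)$. For a graph $G=(V,E)$ on $n$ vertices: $A(G)$ is the adjacency matrix, $D(G)$ the diagonal degree matrix, $L(G)=D(G)-A(G)$, $Q(G)=D(G)+A(G)$; $\lambda_n(G)$ is the smallest eigenvalue of $A(G)$, $\mu_1(G)$ the largest eigenvalue of $L(G)$, $q_n(G)$ the smallest eigenvalue of $Q(G)$; $W=|E|$; $mcut(G)$ is the maximum over $X\subseteq V$ of the number of edges with exactly one endpoint in $X$. $G$ is $L$-exact if $\mu_1(G)=\frac{4}{n}mcut(G)$; $Q$-exact if $q_n(G)=\frac{4}{n}(W-mcut(G))$; $A$-exact if $\lambda_n(G)=\frac{2}{n}(W-2\,mcut(G))$. *)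

theory Defs
  imports "Jordan_Normal_Form.Char_Poly" "HOL-Library.Countable_Set"
begin

record 'a ugraph =
  verts :: "'a set"
  edges :: "'a set set"

definition simple_graph :: "'a ugraph \<Rightarrow> bool" where
  "simple_graph G \<longleftrightarrow>
     finite (verts G) \<and> (\<forall>e\<in>edges G. e \<subseteq> verts G \<and> card e = 2)"

definition complete_graph :: "nat \<Rightarrow> nat ugraph" where
  "complete_graph n = \<lparr>verts = {..<n}, edges = {e. e \<subseteq> {..<n} \<and> card e = 2}\<rparr>"

definition copies :: "nat \<Rightarrow> 'a ugraph \<Rightarrow> (nat \<times> 'a) ugraph" where
  "copies t G = \<lparr>verts = {..<t} \<times> verts G,
                 edges = {Pair i ` e | i e. i < t \<and> e \<in> edges G}\<rparr>"

text \<open>The sum type makes the two vertex sets disjoint.\<close>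

definition join :: "'a ugraph \<Rightarrow> 'b ugraph \<Rightarrow> ('a + 'b) ugraph"  (infixl \<open>\<nabla>\<close> 65) where
  "G \<nabla> H = \<lparr>verts = verts G <+> verts H,
             edges = (\<lambda>e. Inl ` e) ` edges G \<union> (\<lambda>e. Inr ` e) ` edges H
                     \<union> {{Inl u, Inr v} | u v. u \<in> verts G \<and> v \<in> verts H}\<rparr>"

definition num_verts :: "'a ugraph \<Rightarrow> nat" where
  "num_verts G = card (verts G)"

definition num_edges :: "'a ugraph \<Rightarrow> nat" where
  "num_edges G = card (edges G)"

definition vertex_degree :: "'a ugraph \<Rightarrow> 'a \<Rightarrow> nat" where
  "vertex_degree G v = card {e \<in> edges G. v \<in> e}"

definition mcut :: "'a ugraph \<Rightarrow> nat" where
  "mcut G = Max ((\<lambda>X. card {e \<in> edges G. card (e \<inter> X) = 1}) ` Pow (verts G))"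

text \<open>
  Matrices of type \<^typ>\<open>real mat\<close> are indexed by natural numbers, so the vertices must be
  numbered. For a finite set \<open>S\<close>, \<^term>\<open>from_nat_into S\<close> is a bijection from
  \<^term>\<open>{..<card S}\<close> onto \<open>S\<close> (lemma \<open>bij_betw_from_nat_into_finite\<close>); another numbering
  conjugates the matrices below by a permutation matrix and leaves their eigenvalues unchanged.
\<close>

definition vertex :: "'a ugraph \<Rightarrow> nat \<Rightarrow> 'a" where
  "vertex G = from_nat_into (verts G)"

definition adjacency_matrix :: "'a ugraph \<Rightarrow> real mat" where
  "adjacency_matrix G =
     mat (num_verts G) (num_verts G) (\<lambda>(i, j). if {vertex G i, vertex G j} \<in> edges G then 1 else 0)"

definition degree_matrix :: "'a ugraph \<Rightarrow> real mat" where
  "degree_matrix G =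
     mat (num_verts G) (num_verts G) (\<lambda>(i, j). if i = j then real (vertex_degree G (vertex G i)) else 0)"

definition laplacian :: "'a ugraph \<Rightarrow> real mat" where
  "laplacian G = degree_matrix G - adjacency_matrix G"

definition signless_laplacian :: "'a ugraph \<Rightarrow> real mat" where
  "signless_laplacian G = degree_matrix G + adjacency_matrix G"

text \<open>
  For a nonempty simple graph the three matrices are real symmetric, so each
  \<^term>\<open>Collect (eigenvalue M)\<close> is finite and nonempty and \<open>Min\<close>, \<open>Max\<close> are meaningful.
\<close>

definition least_eigenvalue :: "real mat \<Rightarrow> real" where
  "least_eigenvalue M = Min (Collect (eigenvalue M))"

definition greatest_eigenvalue :: "real mat \<Rightarrow> real" where
  "greatest_eigenvalue M = Max (Collect (eigenvalue M))"

definition L_exact :: "'a ugraph \<Rightarrow> bool" where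
  "L_exact G \<longleftrightarrow>
     greatest_eigenvalue (laplacian G) = 4 / real (num_verts G) * real (mcut G)"

definition Q_exact :: "'a ugraph \<Rightarrow> bool" where
  "Q_exact G \<longleftrightarrow>
     least_eigenvalue (signless_laplacian G)
       = 4 / real (num_verts G) * (real (num_edges G) - real (mcut G))"

definition A_exact :: "'a ugraph \<Rightarrow> bool" where
  "A_exact G \<longleftrightarrow>
     least_eigenvalue (adjacency_matrix G)
       = 2 / real (num_verts G) * (real (num_edges G) - 2 * real (mcut G))"

lemma simple_graph_complete_graph: "simple_graph (complete_graph n)"
  by (simp add: simple_graph_def complete_graph_def)

lemma simple_graph_copies:
  assumes "simple_graph G"
  shows "simple_graph (copies t G)"
  using assms by (auto simp: simple_graph_def copies_def card_image inj_on_def)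

lemma simple_graph_join:
  assumes "simple_graph G" and "simple_graph H"
  shows "simple_graph (G \<nabla> H)"
  using assms by (auto simp: simple_graph_def join_def card_image)

end

theory Submission
  imports Defs
begin

text \<open>
  Write \<open>a, b\<close> for the vertices of the joined edge and call the \<open>t\<close> copies of \<open>K\<^sub>2\<close> in the other
  factor pairs. The graph has \<open>n = 2t + 2\<close> vertices and \<open>W = 5t + 1\<close> edges. If a vertex set separates
  \<open>a\<close> from \<open>b\<close>, it cuts the edge \<open>ab\<close> and at most three of the five edges meeting each pair; otherwise it
  cuts at most four of those five. Hence \<open>mcut = max (3t + 1) (4t) = 4t\<close>, attained by \<open>{a, b}\<close>
  (lemma \<open>mcut_edge_join_matching\<close>), and the three candidate values are
  \<^item> \<open>Q\<close>: \<open>4 (W - mcut) / n = 2\<close>,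
  \<^item> \<open>L\<close>: \<open>4 mcut / n = 8t / (t + 1)\<close>,
  \<^item> \<open>A\<close>: \<open>2 (W - 2 mcut) / n = (1 - 3t) / (t + 1)\<close>.

  An eigenvector that takes the values \<open>1, -1\<close> on one pair shows that \<open>2\<close> is an eigenvalue of the
  signless Laplacian, and solving the eigenvalue equations for \<open>k < 2\<close> leaves only the zero vector
  (lemma \<open>eigenvalue_signless_edge_join_matching_ge\<close>); so the graph is \<open>Q\<close>-exact. The two failures
  need one eigenvalue each: the Laplacian has the eigenvalue \<open>n = 2t + 2\<close>, and
  \<open>2t + 2 > 8t / (t + 1)\<close> amounts to \<open>(t - 1)\<^sup>2 > 0\<close>; the adjacency matrix has the eigenvalue
  \<open>1 - 2 \<surd>t\<close>, and \<open>1 - 2 \<surd>t < (1 - 3t) / (t + 1)\<close> amounts to \<open>(\<surd>t - 1)\<^sup>2 > 0\<close>. Both comparisons are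
  equalities for \<open>t = 1\<close>, where the graph is \<open>K\<^sub>4\<close>.

  All matrix computations go through \<open>neighbour_sum\<close>, the action of the adjacency matrix on functions
  on the vertices, which makes the numbering of the vertices disappear. The same operator
  counts edges and cuts, because summing over all vertices counts every edge twice.
\<close>

section \<open>Eigenvalues as equations on vertex functions\<close>

definition neighbour_sum :: "'a ugraph \<Rightarrow> ('a \<Rightarrow> real) \<Rightarrow> 'a \<Rightarrow> real" where
  "neighbour_sum G x v = (\<Sum>w\<in>verts G. if {v, w} \<in> edges G then x w else 0)"

text \<open>
  Transporting a vector along the numbering of \<open>S\<close> turns the matrix equation into one equation for each
  element of \<open>S\<close>; the numbering cancels because it is a bijection.
\<close>

lemma eigenvalue_indexed_matrix_iff:
  fixes F :: "'a \<Rightarrow> 'a \<Rightarrow> real"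
  assumes "finite S"
  shows "eigenvalue (mat (card S) (card S) (\<lambda>(i, j). F (from_nat_into S i) (from_nat_into S j))) k
    \<longleftrightarrow> (\<exists>x. (\<exists>v\<in>S. x v \<noteq> 0) \<and> (\<forall>v\<in>S. (\<Sum>w\<in>S. F v w * x w) = k * x v))"
    (is "eigenvalue ?M k \<longleftrightarrow> ?R")
proof -
  define n where "n = card S"
  define f where "f = from_nat_into S"
  define g where "g = the_inv_into {..<n} f"
  have bij: "bij_betw f {..<n} S"
    unfolding f_def n_def by (rule bij_betw_from_nat_into_finite[OF assms])
  have fS: "f i \<in> S" if "i < n" for i
    using bij that by (auto simp: bij_betw_def)
  have gf: "g (f i) = i" if "i < n" for i
    using bij that by (simp add: g_def bij_betw_def the_inv_into_f_f)
  have surj: "\<exists>i<n. v = f i" if "v \<in> S" for v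
    using bij that by (auto simp: bij_betw_def)
  have M: "?M = mat n n (\<lambda>(i, j). F (f i) (f j))"
    by (simp add: n_def f_def)
  have mult: "(?M *\<^sub>v u) $ i = (\<Sum>w\<in>S. F (f i) w * u $ g w)"
    if "u \<in> carrier_vec n" "i < n" for u i
  proof -
    have "(?M *\<^sub>v u) $ i = (\<Sum>j<n. F (f i) (f j) * u $ g (f j))"
      unfolding M using that by (simp add: scalar_prod_def gf atLeast0LessThan)
    also have "\<dots> = (\<Sum>w\<in>S. F (f i) w * u $ g w)"
      by (rule sum.reindex_bij_betw[OF bij])
    finally show ?thesis .
  qed
  show ?thesis
  proof
    assume "eigenvalue ?M k"
    then obtain u where u: "u \<in> carrier_vec n" "u \<noteq> 0\<^sub>v n" "?M *\<^sub>v u = k \<cdot>\<^sub>v u"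
      by (auto simp: eigenvalue_def eigenvector_def n_def)
    obtain i where "i < n" "u $ i \<noteq> 0"
      using u(1,2) by (metis carrier_vecD eq_vecI index_zero_vec(1) index_zero_vec(2))
    then have "\<exists>v\<in>S. u $ g v \<noteq> 0"
      using fS gf by metis
    moreover have "(\<Sum>w\<in>S. F v w * u $ g w) = k * u $ g v" if v: "v \<in> S" for v
    proof -
      obtain i where i: "i < n" "v = f i"
        using surj[OF v] by blast
      show ?thesis
        using mult[OF u(1) i(1)] u(1,3) i by (simp add: gf)
    qed
    ultimately show ?R
      by (intro exI[of _ "\<lambda>v. u $ g v"]) auto
  next
    assume ?R
    then obtain x where x: "\<exists>v\<in>S. x v \<noteq> 0" "\<And>v. v \<in> S \<Longrightarrow> (\<Sum>w\<in>S. F v w * x w) = k * x v"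
      by blast
    define u where "u = vec n (\<lambda>i. x (f i))"
    have u: "u \<in> carrier_vec n"
      by (simp add: u_def)
    have ug: "u $ g w = x w" if "w \<in> S" for w
      using surj[OF that] by (auto simp: u_def gf)
    have "u \<noteq> 0\<^sub>v n"
    proof
      assume "u = 0\<^sub>v n"
      then have "x (f i) = 0" if "i < n" for i
        using that by (metis index_vec index_zero_vec(1) u_def)
      then show False
        using x(1) surj by blast
    qed
    moreover have "?M *\<^sub>v u = k \<cdot>\<^sub>v u"
    proof (rule eq_vecI)
      fix i assume "i < dim_vec (k \<cdot>\<^sub>v u)"
      then have i: "i < n"
        using u by simp
      have "(?M *\<^sub>v u) $ i = (\<Sum>w\<in>S. F (f i) w * x w)"
        unfolding mult[OF u i] by (intro sum.cong) (simp_all add: ug)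
      also have "\<dots> = k * x (f i)"
        by (rule x(2)[OF fS[OF i]])
      finally show "(?M *\<^sub>v u) $ i = (k \<cdot>\<^sub>v u) $ i"
        using i by (simp add: u_def)
    qed (simp add: u_def n_def)
    ultimately show "eigenvalue ?M k"
      using u by (auto simp: eigenvalue_def eigenvector_def n_def)
  qed
qed

text \<open>
  Finiteness is what lets a single eigenvalue bound the \<open>Min\<close> or \<open>Max\<close> of a spectrum.
\<close>

lemma finite_eigenvalues:
  fixes M :: "real mat"
  assumes "M \<in> carrier_mat n n"
  shows "finite (Collect (eigenvalue M))"
proof -
  have "char_poly M \<noteq> 0"
    using degree_monic_char_poly[OF assms] by auto
  then have "finite {k. poly (char_poly M) k = 0}"
    by (rule poly_roots_finite)
  then show ?thesis
    by (simp add: eigenvalue_root_char_poly[OF assms, abs_def])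
qed

lemma eigenvalue_adjacency_iff:
  assumes "simple_graph G"
  shows "eigenvalue (adjacency_matrix G) k \<longleftrightarrow>
    (\<exists>x. (\<exists>v\<in>verts G. x v \<noteq> 0) \<and> (\<forall>v\<in>verts G. neighbour_sum G x v = k * x v))"
proof -
  have fin: "finite (verts G)"
    using assms by (simp add: simple_graph_def)
  show ?thesis
    unfolding adjacency_matrix_def vertex_def num_verts_def
      eigenvalue_indexed_matrix_iff[OF fin, of "\<lambda>v w. if {v, w} \<in> edges G then 1 else 0"]
      neighbour_sum_def if_distrib[of "\<lambda>c. c * _"] mult_1 mult_zero_left ..
qed

text \<open>
  The Laplacian and the signless Laplacian are the cases \<open>c = -1\<close> and \<open>c = 1\<close>.
\<close>

lemma eigenvalue_degree_combination_iff:
  assumes "finite (verts G)"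
  shows "eigenvalue (degree_matrix G + c \<cdot>\<^sub>m adjacency_matrix G) k \<longleftrightarrow>
    (\<exists>x. (\<exists>v\<in>verts G. x v \<noteq> 0) \<and>
      (\<forall>v\<in>verts G. real (vertex_degree G v) * x v + c * neighbour_sum G x v = k * x v))"
proof -
  define V where "V = verts G"
  define F where "F v w = (if v = w then real (vertex_degree G v) else 0)
      + c * (if {v, w} \<in> edges G then 1 else 0)" for v w
  have fin: "finite V"
    using assms by (simp add: V_def)
  have inj: "from_nat_into V i = from_nat_into V j \<longleftrightarrow> i = j" if "i < card V" "j < card V" for i j
    using bij_betw_from_nat_into_finite[OF fin] that by (auto simp: bij_betw_def inj_on_def)
  have M: "degree_matrix G + c \<cdot>\<^sub>m adjacency_matrix G =
      mat (card V) (card V) (\<lambda>(i, j). F (from_nat_into V i) (from_nat_into V j))"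
    by (rule eq_matI) (auto simp: degree_matrix_def adjacency_matrix_def num_verts_def vertex_def
        F_def inj V_def[symmetric])
  have "(\<Sum>w\<in>V. F v w * x w) = real (vertex_degree G v) * x v + c * neighbour_sum G x v"
    if "v \<in> V" for v x
  proof -
    have "(\<Sum>w\<in>V. F v w * x w) = (\<Sum>w\<in>V. (if v = w then real (vertex_degree G v) * x w else 0)
        + c * (if {v, w} \<in> edges G then x w else 0))"
      by (intro sum.cong) (auto simp: F_def algebra_simps)
    then show ?thesis
      using that fin
      by (simp add: sum.distrib sum_distrib_left[symmetric] neighbour_sum_def V_def[symmetric])
  qed
  then show ?thesis
    unfolding M eigenvalue_indexed_matrix_iff[OF fin] V_def[symmetric] by auto
qed

lemma eigenvalue_signless_laplacian_iff:
  assumes "finite (verts G)"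
  shows "eigenvalue (signless_laplacian G) k \<longleftrightarrow>
    (\<exists>x. (\<exists>v\<in>verts G. x v \<noteq> 0) \<and>
      (\<forall>v\<in>verts G. real (vertex_degree G v) * x v + neighbour_sum G x v = k * x v))"
proof -
  have "signless_laplacian G = degree_matrix G + 1 \<cdot>\<^sub>m adjacency_matrix G"
    by (rule eq_matI) (auto simp: signless_laplacian_def degree_matrix_def adjacency_matrix_def)
  then show ?thesis
    using eigenvalue_degree_combination_iff[OF assms, of 1 k] by simp
qed

lemma eigenvalue_laplacian_iff:
  assumes "finite (verts G)"
  shows "eigenvalue (laplacian G) k \<longleftrightarrow>
    (\<exists>x. (\<exists>v\<in>verts G. x v \<noteq> 0) \<and>
      (\<forall>v\<in>verts G. real (vertex_degree G v) * x v - neighbour_sum G x v = k * x v))"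
proof -
  have "laplacian G = degree_matrix G + (-1) \<cdot>\<^sub>m adjacency_matrix G"
    by (rule eq_matI) (auto simp: laplacian_def degree_matrix_def adjacency_matrix_def)
  then show ?thesis
    using eigenvalue_degree_combination_iff[OF assms, of "-1" k] by simp
qed

section \<open>Counting edges by their endpoints\<close>

lemma vertex_degree_eq_neighbour_sum:
  assumes "simple_graph G"
  shows "real (vertex_degree G v) = neighbour_sum G (\<lambda>_. 1) v"
proof -
  have fin: "finite (verts G)" and E: "\<And>e. e \<in> edges G \<Longrightarrow> e \<subseteq> verts G \<and> card e = 2"
    using assms by (auto simp: simple_graph_def)
  let ?N = "{w \<in> verts G. {v, w} \<in> edges G}"
  have "bij_betw (\<lambda>w. {v, w}) ?N {e \<in> edges G. v \<in> e}"
    unfolding bij_betw_def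
  proof
    show "inj_on (\<lambda>w. {v, w}) ?N"
      by (auto simp: inj_on_def doubleton_eq_iff)
    show "(\<lambda>w. {v, w}) ` ?N = {e \<in> edges G. v \<in> e}"
    proof (intro equalityI subsetI)
      fix e assume e: "e \<in> {e \<in> edges G. v \<in> e}"
      then obtain a b where ab: "e = {a, b}"
        using E by (metis (no_types, lifting) card_2_iff mem_Collect_eq)
      then have "e = {v, a} \<or> e = {v, b}"
        using e by auto
      then show "e \<in> (\<lambda>w. {v, w}) ` ?N"
        using e E ab by fastforce
    qed auto
  qed
  then have "vertex_degree G v = card ?N"
    unfolding vertex_degree_def by (simp add: bij_betw_same_card)
  then show ?thesis
    using fin by (simp add: neighbour_sum_def sum.If_cases Int_def)
qed

text \<open>
  The handshake lemma for the edges with property \<open>P\<close>: each of them is seen from both of its endpoints.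
\<close>

lemma card_edges_double_count:
  assumes "simple_graph G"
  shows "2 * real (card {e \<in> edges G. P e}) =
    (\<Sum>v\<in>verts G. neighbour_sum G (\<lambda>w. of_bool (P {v, w})) v)"
proof -
  have fin: "finite (verts G)" and E: "\<And>e. e \<in> edges G \<Longrightarrow> e \<subseteq> verts G \<and> card e = 2"
    using assms by (auto simp: simple_graph_def)
  \<comment> \<open>The edges satisfying \<open>P\<close> form a graph of their own; its degree sum is counted.\<close>
  let ?F = "{e \<in> edges G. P e}"
  let ?H = "\<lparr>verts = verts G, edges = ?F\<rparr>"
  have finF: "finite ?F"
    using fin E by (intro finite_subset[of ?F "Pow (verts G)"]) auto
  have "2 * card ?F = (\<Sum>e\<in>?F. card {v \<in> verts G. v \<in> e})"
  proof -
    have "card {v \<in> verts G. v \<in> e} = 2" if "e \<in> ?F" for e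
    proof -
      have "{v \<in> verts G. v \<in> e} = e"
        using that E by blast
      then show ?thesis
        using that E by simp
    qed
    then show ?thesis
      by simp
  qed
  also have "\<dots> = (\<Sum>v\<in>verts G. card {e \<in> ?F. v \<in> e})"
    using sum_multicount_gen[OF fin finF, of "\<lambda>v e. v \<in> e" "\<lambda>e. card {v \<in> verts G. v \<in> e}"]
    by simp
  finally have "2 * real (card ?F) = (\<Sum>v\<in>verts G. real (vertex_degree ?H v))"
    unfolding vertex_degree_def ugraph.simps of_nat_sum[symmetric]
    by (metis of_nat_mult of_nat_numeral)
  also have "\<dots> = (\<Sum>v\<in>verts G. neighbour_sum ?H (\<lambda>_. 1) v)"
    using assms by (intro sum.cong vertex_degree_eq_neighbour_sum) (auto simp: simple_graph_def)
  also have "\<dots> = (\<Sum>v\<in>verts G. neighbour_sum G (\<lambda>w. of_bool (P {v, w})) v)"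
    unfolding neighbour_sum_def by (intro sum.cong) auto
  finally show ?thesis .
qed

lemma card_doubleton_Int_eq_1_iff:
  assumes "v \<noteq> w"
  shows "card ({v, w} \<inter> X) = 1 \<longleftrightarrow> (v \<in> X) \<noteq> (w \<in> X)"
  using assms by (cases "v \<in> X"; cases "w \<in> X") auto

lemma card_cut_double_count:
  assumes "simple_graph G"
  shows "2 * real (card {e \<in> edges G. card (e \<inter> X) = 1}) =
    (\<Sum>v\<in>verts G. neighbour_sum G (\<lambda>w. of_bool ((v \<in> X) \<noteq> (w \<in> X))) v)"
  unfolding card_edges_double_count[OF assms]
proof (intro sum.cong refl)
  fix v
  have "v \<noteq> w" if "{v, w} \<in> edges G" for w
    using assms that by (auto simp: simple_graph_def)
  then show "neighbour_sum G (\<lambda>w. of_bool (card ({v, w} \<inter> X) = 1)) v =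
      neighbour_sum G (\<lambda>w. of_bool ((v \<in> X) \<noteq> (w \<in> X))) v"
    unfolding neighbour_sum_def
    by (intro sum.cong refl if_cong arg_cong[of _ _ of_bool] card_doubleton_Int_eq_1_iff)
qed

section \<open>Neighbours in complete graphs, copies and joins\<close>

lemma neighbour_sum_complete_graph:
  assumes "v < n"
  shows "neighbour_sum (complete_graph n) x v = (\<Sum>w\<in>{..<n} - {v}. x w)"
proof -
  have "{v, w} \<in> edges (complete_graph n) \<longleftrightarrow> w < n \<and> w \<noteq> v" for w
    using assms by (auto simp: complete_graph_def card_2_iff)
  then show ?thesis
    unfolding neighbour_sum_def
    by (intro sum.mono_neutral_cong_right) (auto simp: complete_graph_def)
qed

lemma neighbour_sum_copies:
  assumes "finite (verts G)" and "i < t"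
  shows "neighbour_sum (copies t G) x (i, v) = neighbour_sum G (\<lambda>w. x (i, w)) v"
proof -
  have E: "{(i, v), (j, w)} \<in> edges (copies t G) \<longleftrightarrow> j = i \<and> {v, w} \<in> edges G" for j w
  proof
    assume "{(i, v), (j, w)} \<in> edges (copies t G)"
    then obtain k e where e: "{(i, v), (j, w)} = Pair k ` e" "e \<in> edges G"
      by (auto simp: copies_def)
    then have ij: "i = k" "j = k"
      by auto
    have "snd ` {(i, v), (j, w)} = e"
      unfolding e(1) by (simp add: image_image)
    then show "j = i \<and> {v, w} \<in> edges G"
      using e(2) ij by auto
  next
    assume "j = i \<and> {v, w} \<in> edges G"
    then show "{(i, v), (j, w)} \<in> edges (copies t G)"
      using assms(2) by (auto simp: copies_def intro!: exI[of _ i] exI[of _ "{v, w}"])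
  qed
  have "neighbour_sum (copies t G) x (i, v) =
      (\<Sum>j<t. \<Sum>w\<in>verts G. if j = i \<and> {v, w} \<in> edges G then x (j, w) else 0)"
    unfolding neighbour_sum_def
    unfolding sum.cartesian_product
    by (intro sum.cong) (auto simp only: E split: prod.split, auto simp: copies_def)
  also have "\<dots> = (\<Sum>j<t. if j = i then neighbour_sum G (\<lambda>w. x (i, w)) v else 0)"
    unfolding neighbour_sum_def by (intro sum.cong) auto
  finally show ?thesis
    using assms(2) by simp
qed

lemma doubleton_in_edges_join:
  "{Inl u, Inl u'} \<in> edges (G \<nabla> H) \<longleftrightarrow> {u, u'} \<in> edges G"
  "{Inr v, Inr v'} \<in> edges (G \<nabla> H) \<longleftrightarrow> {v, v'} \<in> edges H"
  "{Inl u, Inr v} \<in> edges (G \<nabla> H) \<longleftrightarrow> u \<in> verts G \<and> v \<in> verts H"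
proof -
  have no_l: "{Inl u, w} \<noteq> Inr ` e" for u w and e :: "'b set"
    by auto
  have no_r: "{w, Inr v} \<noteq> Inl ` e" for v w and e :: "'a set"
    by auto
  have l: "{Inl u, Inl u'} = Inl ` e \<longleftrightarrow> e = {u, u'}" for e :: "'a set"
    by (metis (no_types, lifting) image_empty image_insert inj_Inl inj_image_eq_iff)
  have r: "{Inr v, Inr v'} = Inr ` e \<longleftrightarrow> e = {v, v'}" for e :: "'b set"
    by (metis (no_types, lifting) image_empty image_insert inj_Inr inj_image_eq_iff)
  show "{Inl u, Inl u'} \<in> edges (G \<nabla> H) \<longleftrightarrow> {u, u'} \<in> edges G"
    by (auto simp: join_def image_iff no_l l doubleton_eq_iff)
  show "{Inr v, Inr v'} \<in> edges (G \<nabla> H) \<longleftrightarrow> {v, v'} \<in> edges H"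
    by (auto simp: join_def image_iff no_r r doubleton_eq_iff)
  show "{Inl u, Inr v} \<in> edges (G \<nabla> H) \<longleftrightarrow> u \<in> verts G \<and> v \<in> verts H"
    by (auto simp: join_def image_iff no_l no_r doubleton_eq_iff)
qed

lemma sum_verts_join:
  assumes "finite (verts G)" and "finite (verts H)"
  shows "(\<Sum>w\<in>verts (G \<nabla> H). f w) = (\<Sum>u\<in>verts G. f (Inl u)) + (\<Sum>v\<in>verts H. f (Inr v))"
  using assms by (simp add: join_def sum.Plus)

text \<open>
  A vertex of a join sees its neighbours in its own factor and every vertex of the other factor.
\<close>

lemma neighbour_sum_join:
  assumes "finite (verts G)" and "finite (verts H)"
  shows "u \<in> verts G \<Longrightarrow> neighbour_sum (G \<nabla> H) x (Inl u) =
      neighbour_sum G (\<lambda>w. x (Inl w)) u + (\<Sum>v\<in>verts H. x (Inr v))"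
    and "v \<in> verts H \<Longrightarrow> neighbour_sum (G \<nabla> H) x (Inr v) =
      (\<Sum>u\<in>verts G. x (Inl u)) + neighbour_sum H (\<lambda>w. x (Inr w)) v"
  unfolding neighbour_sum_def sum_verts_join[OF assms]
  by (simp_all add: doubleton_in_edges_join insert_commute[of "Inr _" "Inl _"])

section \<open>The graph \<open>K\<^sub>2 \<nabla> tK\<^sub>2\<close>\<close>

definition edge_join_matching :: "nat \<Rightarrow> (nat + nat \<times> nat) ugraph" where
  "edge_join_matching t = complete_graph 2 \<nabla> copies t (complete_graph 2)"

lemma simple_graph_edge_join_matching: "simple_graph (edge_join_matching t)"
  unfolding edge_join_matching_def
  by (intro simple_graph_join simple_graph_copies simple_graph_complete_graph)

lemma finite_verts_edge_join_matching: "finite (verts (edge_join_matching t))"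
  using simple_graph_edge_join_matching by (simp add: simple_graph_def)

lemma verts_complete_graph_2: "verts (complete_graph 2) = {0, 1}"
  by (auto simp: complete_graph_def)

lemma ball_verts_edge_join_matching:
  "(\<forall>v\<in>verts (edge_join_matching t). P v) \<longleftrightarrow>
    P (Inl 0) \<and> P (Inl 1) \<and> (\<forall>i<t. P (Inr (i, 0)) \<and> P (Inr (i, 1)))"
  by (auto simp: edge_join_matching_def join_def copies_def verts_complete_graph_2)

lemma sum_verts_matching:
  "(\<Sum>v\<in>verts (copies t (complete_graph 2)). f v) = (\<Sum>i<t. f (i, 0) + f (i, 1))"
proof -
  have "(\<Sum>v\<in>verts (copies t (complete_graph 2)). f v) = (\<Sum>i<t. \<Sum>j\<in>{0, 1}. f (i, j))"
    by (simp only: copies_def ugraph.simps verts_complete_graph_2 sum.cartesian_product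
        split_def prod.collapse)
  then show ?thesis
    by simp
qed

lemma sum_verts_edge_join_matching:
  fixes f :: "nat + nat \<times> nat \<Rightarrow> real"
  shows "(\<Sum>v\<in>verts (edge_join_matching t). f v) =
    f (Inl 0) + f (Inl 1) + (\<Sum>i<t. f (Inr (i, 0)) + f (Inr (i, 1)))"
proof -
  have fin: "finite (verts (complete_graph 2))" "finite (verts (copies t (complete_graph 2)))"
    by (simp_all add: copies_def verts_complete_graph_2)
  show ?thesis
    unfolding edge_join_matching_def sum_verts_join[OF fin] sum_verts_matching
    by (simp add: verts_complete_graph_2)
qed

lemma num_verts_edge_join_matching: "real (num_verts (edge_join_matching t)) = 2 * real t + 2"
  using sum_verts_edge_join_matching[of "\<lambda>_. 1" t] by (simp add: num_verts_def)

lemma neighbour_sum_edge_join_matching: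
  "neighbour_sum (edge_join_matching t) x (Inl 0) =
    x (Inl 1) + (\<Sum>i<t. x (Inr (i, 0)) + x (Inr (i, 1)))"
  "neighbour_sum (edge_join_matching t) x (Inl 1) =
    x (Inl 0) + (\<Sum>i<t. x (Inr (i, 0)) + x (Inr (i, 1)))"
  "i < t \<Longrightarrow> neighbour_sum (edge_join_matching t) x (Inr (i, 0)) =
    x (Inl 0) + x (Inl 1) + x (Inr (i, 1))"
  "i < t \<Longrightarrow> neighbour_sum (edge_join_matching t) x (Inr (i, 1)) =
    x (Inl 0) + x (Inl 1) + x (Inr (i, 0))"
proof -
  let ?K = "complete_graph 2"
  have fin: "finite (verts ?K)" "finite (verts (copies t ?K))"
    by (simp_all add: copies_def verts_complete_graph_2)
  have K: "neighbour_sum ?K y 0 = y 1" "neighbour_sum ?K y 1 = y 0" for y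
  proof -
    have "{..<2::nat} - {0} = {1}" "{..<2::nat} - {1} = {0}"
      by auto
    then show "neighbour_sum ?K y 0 = y 1" "neighbour_sum ?K y 1 = y 0"
      by (simp_all add: neighbour_sum_complete_graph)
  qed
  have l: "0 \<in> verts ?K" "1 \<in> verts ?K"
    by (simp_all add: verts_complete_graph_2)
  show "neighbour_sum (edge_join_matching t) x (Inl 0) =
      x (Inl 1) + (\<Sum>i<t. x (Inr (i, 0)) + x (Inr (i, 1)))"
    "neighbour_sum (edge_join_matching t) x (Inl 1) =
      x (Inl 0) + (\<Sum>i<t. x (Inr (i, 0)) + x (Inr (i, 1)))"
    unfolding edge_join_matching_def
    by (simp_all only: neighbour_sum_join(1)[OF fin l(1)] neighbour_sum_join(1)[OF fin l(2)] K
        sum_verts_matching)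
  assume i: "i < t"
  have r: "(i, 0) \<in> verts (copies t ?K)" "(i, 1) \<in> verts (copies t ?K)"
    using i by (simp_all add: copies_def verts_complete_graph_2)
  show "neighbour_sum (edge_join_matching t) x (Inr (i, 0)) =
      x (Inl 0) + x (Inl 1) + x (Inr (i, 1))"
    "neighbour_sum (edge_join_matching t) x (Inr (i, 1)) =
      x (Inl 0) + x (Inl 1) + x (Inr (i, 0))"
    unfolding edge_join_matching_def neighbour_sum_join(2)[OF fin r(1)]
      neighbour_sum_join(2)[OF fin r(2)] neighbour_sum_copies[OF fin(1) i] K
    by (simp_all add: verts_complete_graph_2)
qed

lemma vertex_degree_edge_join_matching:
  "real (vertex_degree (edge_join_matching t) (Inl 0)) = 2 * real t + 1"
  "real (vertex_degree (edge_join_matching t) (Inl 1)) = 2 * real t + 1"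
  "i < t \<Longrightarrow> real (vertex_degree (edge_join_matching t) (Inr (i, 0))) = 3"
  "i < t \<Longrightarrow> real (vertex_degree (edge_join_matching t) (Inr (i, 1))) = 3"
  unfolding vertex_degree_eq_neighbour_sum[OF simple_graph_edge_join_matching]
    neighbour_sum_edge_join_matching
  by simp_all

text \<open>
  The simplifier rewrites the vertex label \<open>1\<close> to \<open>Suc 0\<close>, so rewrite rules must have that form.
\<close>

lemmas edge_join_matching_simps =
  vertex_degree_edge_join_matching[unfolded One_nat_def]
  neighbour_sum_edge_join_matching[unfolded One_nat_def]

lemma num_edges_edge_join_matching: "real (num_edges (edge_join_matching t)) = 5 * real t + 1"
proof -
  have "2 * real (num_edges (edge_join_matching t)) =
      (\<Sum>v\<in>verts (edge_join_matching t). neighbour_sum (edge_join_matching t) (\<lambda>_. 1) v)"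
    using card_edges_double_count[OF simple_graph_edge_join_matching, of t "\<lambda>_. True"]
    by (simp add: num_edges_def)
  also have "\<dots> = 2 * (5 * real t + 1)"
    unfolding sum_verts_edge_join_matching by (simp add: edge_join_matching_simps algebra_simps)
  finally show ?thesis
    by simp
qed

text \<open>
  The indicator \<open>d v w\<close> says whether the cut separates \<open>v\<close> from \<open>w\<close>. The edge inside \<open>K\<^sub>2\<close>
  contributes the first term; the summand for \<open>i\<close> collects the five edges meeting the pair \<open>i\<close>.
\<close>

lemma card_cut_edge_join_matching:
  fixes X :: "(nat + nat \<times> nat) set"
  defines "d \<equiv> \<lambda>v w. of_bool ((v \<in> X) \<noteq> (w \<in> X)) :: real"
  shows "real (card {e \<in> edges (edge_join_matching t). card (e \<inter> X) = 1}) =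
    d (Inl 0) (Inl 1) +
    (\<Sum>i<t. d (Inl 0) (Inr (i, 0)) + d (Inl 0) (Inr (i, 1)) + d (Inl 1) (Inr (i, 0))
          + d (Inl 1) (Inr (i, 1)) + d (Inr (i, 0)) (Inr (i, 1)))" (is "?c = ?r")
proof -
  have sym: "d v w = d w v" for v w
    by (auto simp: d_def)
  have "2 * ?c =
      (\<Sum>v\<in>verts (edge_join_matching t). neighbour_sum (edge_join_matching t) (d v) v)"
    unfolding d_def by (rule card_cut_double_count[OF simple_graph_edge_join_matching])
  also have "\<dots> = d (Inl 0) (Inl 1) + (\<Sum>i<t. d (Inl 0) (Inr (i, 0)) + d (Inl 0) (Inr (i, 1)))
      + (d (Inl 1) (Inl 0) + (\<Sum>i<t. d (Inl 1) (Inr (i, 0)) + d (Inl 1) (Inr (i, 1))))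
      + (\<Sum>i<t. (d (Inr (i, 0)) (Inl 0) + d (Inr (i, 0)) (Inl 1) + d (Inr (i, 0)) (Inr (i, 1)))
            + (d (Inr (i, 1)) (Inl 0) + d (Inr (i, 1)) (Inl 1) + d (Inr (i, 1)) (Inr (i, 0))))"
    unfolding sum_verts_edge_join_matching neighbour_sum_edge_join_matching(1,2)
    by (intro arg_cong2[of _ _ _ _ "(+)"] refl sum.cong)
      (simp_all only: lessThan_iff neighbour_sum_edge_join_matching(3,4))
  also have "\<dots> = 2 * ?r"
    by (simp add: sym[of "Inr _" "Inl _"] sym[of "Inl (Suc 0)" "Inl 0"]
        sym[of "Inr (_, Suc 0)" "Inr (_, 0)"] sum.distrib
        sum_distrib_left)
  finally show ?thesis
    by simp
qed

lemma mcut_edge_join_matching: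
  assumes "t \<ge> 1"
  shows "mcut (edge_join_matching t) = 4 * t"
  unfolding mcut_def
proof (rule Max_eqI)
  show "finite ((\<lambda>X. card {e \<in> edges (edge_join_matching t). card (e \<inter> X) = 1})
      ` Pow (verts (edge_join_matching t)))"
    using finite_verts_edge_join_matching by simp
next
  fix c
  assume "c \<in> (\<lambda>X. card {e \<in> edges (edge_join_matching t). card (e \<inter> X) = 1})
      ` Pow (verts (edge_join_matching t))"
  then obtain X where c: "c = card {e \<in> edges (edge_join_matching t). card (e \<inter> X) = 1}"
    by blast
  let ?d = "\<lambda>v w. of_bool ((v \<in> X) \<noteq> (w \<in> X)) :: real"
  let ?s = "\<lambda>i. ?d (Inl 0) (Inr (i, 0)) + ?d (Inl 0) (Inr (i, 1)) + ?d (Inl 1) (Inr (i, 0))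
          + ?d (Inl 1) (Inr (i, 1)) + ?d (Inr (i, 0)) (Inr (i, 1))"
  \<comment> \<open>A pair together with an endpoint of the edge \<open>ab\<close> spans a triangle, of which a cut contains at
    most two edges. When the cut separates \<open>a\<close> from \<open>b\<close>, each vertex of the pair is separated from
    exactly one of them, leaving two such edges and at most the edge of the pair.\<close>
  have "?s i \<le> 4 - ?d (Inl 0) (Inl 1)" for i
    by auto
  then have "(\<Sum>i<t. ?s i) \<le> (\<Sum>i<t. 4 - ?d (Inl 0) (Inl 1))"
    by (rule sum_mono)
  then have "real c \<le> ?d (Inl 0) (Inl 1) + real t * (4 - ?d (Inl 0) (Inl 1))"
    unfolding c card_cut_edge_join_matching by simp
  also have "\<dots> \<le> 4 * real t"
    using assms by auto
  finally show "c \<le> 4 * t"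
    by linarith
next
  have "real (card {e \<in> edges (edge_join_matching t). card (e \<inter> {Inl 0, Inl 1}) = 1}) = 4 * real t"
    unfolding card_cut_edge_join_matching by simp
  then have "4 * t = card {e \<in> edges (edge_join_matching t). card (e \<inter> {Inl 0, Inl 1}) = 1}"
    by linarith
  moreover have "{Inl 0, Inl 1} \<in> Pow (verts (edge_join_matching t))"
    by (simp add: edge_join_matching_def join_def verts_complete_graph_2 InlI)
  ultimately show "4 * t \<in> (\<lambda>X. card {e \<in> edges (edge_join_matching t). card (e \<inter> X) = 1})
      ` Pow (verts (edge_join_matching t))"
    by (rule image_eqI)
qed

section \<open>The three spectra\<close>

text \<open>
  For \<open>k < 2\<close> the coefficients \<open>2 - k\<close> and \<open>2t - k\<close> of the differences across an edge of
  the matching and across the joined edge are nonzero, so an eigenvector is constant on each pair and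
  on the joined edge. It then takes the same value on all pairs and is an eigenvector of the
  quotient matrix with rows \<open>(2t + 2, 2t)\<close> and \<open>(2, 4)\<close>, whose eigenvalues are \<open>2\<close> and \<open>2t + 4\<close>.
\<close>

lemma eigenvalue_signless_edge_join_matching_ge:
  assumes "t \<ge> 1" and "eigenvalue (signless_laplacian (edge_join_matching t)) k"
  shows "2 \<le> k"
proof (rule ccontr)
  assume "\<not> 2 \<le> k"
  then have k: "k < 2"
    by simp
  obtain x where nz: "\<exists>v\<in>verts (edge_join_matching t). x v \<noteq> 0"
    and eq: "\<forall>v\<in>verts (edge_join_matching t).
      real (vertex_degree (edge_join_matching t) v) * x v
        + neighbour_sum (edge_join_matching t) x v = k * x v"
    using assms(2) unfolding eigenvalue_signless_laplacian_iff[OF finite_verts_edge_join_matching]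
    by blast
  define a b where "a = x (Inl 0)" and "b = x (Inl 1)"
  define S where "S = (\<Sum>i<t. x (Inr (i, 0)) + x (Inr (i, 1)))"
  note eqs = eq[unfolded ball_verts_edge_join_matching]
  have A: "(2 * real t + 1) * a + (b + S) = k * a" and B: "(2 * real t + 1) * b + (a + S) = k * b"
    using eqs
    unfolding vertex_degree_edge_join_matching(1,2) neighbour_sum_edge_join_matching(1,2)
      a_def b_def S_def by blast+
  have P: "3 * x (Inr (i, 0)) + (a + b + x (Inr (i, 1))) = k * x (Inr (i, 0))"
    and P': "3 * x (Inr (i, 1)) + (a + b + x (Inr (i, 0))) = k * x (Inr (i, 1))" if "i < t" for i
    using eqs that
      vertex_degree_edge_join_matching(3,4)[OF that] neighbour_sum_edge_join_matching(3,4)[OF that, of x]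
    unfolding a_def b_def by metis+
  have "(2 * real t - k) * (a - b) = 0"
    using A B by (simp add: algebra_simps)
  moreover have "2 * real t - k > 0"
    using assms(1) k by linarith
  ultimately have ab: "b = a"
    by simp
  \<comment> \<open>The common value on the pairs, solved from \<open>(4 - k) y + a + b = 0\<close> with \<open>b = a\<close>.\<close>
  define y where "y = - 2 * a / (4 - k)"
  have y: "x (Inr (i, 0)) = y \<and> x (Inr (i, 1)) = y" if "i < t" for i
  proof -
    have "(2 - k) * (x (Inr (i, 0)) - x (Inr (i, 1))) = 0"
      using P[OF that] P'[OF that] by (simp add: algebra_simps)
    then have eq: "x (Inr (i, 1)) = x (Inr (i, 0))"
      using k by simp
    then have "(4 - k) * x (Inr (i, 0)) = - 2 * a"
      using P[OF that] ab by (simp add: algebra_simps)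
    then show ?thesis
      using k eq by (simp add: y_def field_simps)
  qed
  have S: "S = 2 * real t * y"
    unfolding S_def by (simp add: y[unfolded One_nat_def])
  have y4: "(4 - k) * y = - 2 * a"
    using k by (simp add: y_def)
  \<comment> \<open>Eliminating \<open>y\<close> leaves the characteristic polynomial of the quotient matrix.\<close>
  have "(2 * real t + 2 - k) * a + 2 * real t * y = 0"
    using A ab S by (simp add: algebra_simps)
  then have "(4 - k) * ((2 * real t + 2 - k) * a + 2 * real t * y) = 0"
    by simp
  then have "(4 - k) * ((2 * real t + 2 - k) * a) + 2 * real t * ((4 - k) * y) = 0"
    by (simp only: distrib_left mult.left_commute)
  then have "(2 - k) * (2 * real t + 4 - k) * a = 0"
    unfolding y4 by (simp add: algebra_simps)
  then have "a = 0"
    using k assms(1) by simp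
  then have "x v = 0" if "v \<in> verts (edge_join_matching t)" for v
    using that y ab ball_verts_edge_join_matching[of t "\<lambda>v. x v = 0"]
    by (simp add: a_def b_def y_def)
  then show False
    using nz by blast
qed

text \<open>
  The vector is \<open>1, -1\<close> on one pair: its sum over the pair vanishes, so the joined edge sees nothing,
  and on the pair the eigenvalue is the degree \<open>3\<close> minus \<open>1\<close>.
\<close>

lemma eigenvalue_signless_edge_join_matching:
  assumes "t \<ge> 1"
  shows "eigenvalue (signless_laplacian (edge_join_matching t)) 2"
  unfolding eigenvalue_signless_laplacian_iff[OF finite_verts_edge_join_matching]
proof (intro exI conjI)
  let ?x = "\<lambda>v :: nat + nat \<times> nat. if v = Inr (0, 0) then 1 else if v = Inr (0, 1) then - 1 else (0::real)"
  have "Inr (0, 0) \<in> verts (edge_join_matching t)"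
    using assms
    by (simp add: edge_join_matching_def join_def copies_def verts_complete_graph_2 InrI)
  then show "\<exists>v\<in>verts (edge_join_matching t). ?x v \<noteq> 0"
    by (intro bexI[of _ "Inr (0, 0)"]) simp_all
  have "(\<Sum>i<t. ?x (Inr (i, 0)) + ?x (Inr (i, 1))) = 0"
    by (intro sum.neutral) simp
  then show "\<forall>v\<in>verts (edge_join_matching t).
      real (vertex_degree (edge_join_matching t) v) * ?x v
        + neighbour_sum (edge_join_matching t) ?x v = 2 * ?x v"
    unfolding ball_verts_edge_join_matching
    by (simp add: edge_join_matching_simps)
qed

text \<open>
  The vector is \<open>1, -1\<close> on the joined edge: every pair sees the sum \<open>0\<close>, and on the edge the
  eigenvalue is the degree \<open>2t + 1\<close> plus \<open>1\<close>.
\<close>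

lemma eigenvalue_laplacian_edge_join_matching:
  "eigenvalue (laplacian (edge_join_matching t)) (2 * real t + 2)"
  unfolding eigenvalue_laplacian_iff[OF finite_verts_edge_join_matching]
proof (intro exI conjI)
  let ?x = "\<lambda>v :: nat + nat \<times> nat. if v = Inl 0 then 1 else if v = Inl 1 then - 1 else (0::real)"
  have "Inl 0 \<in> verts (edge_join_matching t)"
    by (simp add: edge_join_matching_def join_def verts_complete_graph_2 InlI)
  then show "\<exists>v\<in>verts (edge_join_matching t). ?x v \<noteq> 0"
    by (intro bexI[of _ "Inl 0"]) simp_all
  show "\<forall>v\<in>verts (edge_join_matching t).
      real (vertex_degree (edge_join_matching t) v) * ?x v
        - neighbour_sum (edge_join_matching t) ?x v = (2 * real t + 2) * ?x v"
    unfolding ball_verts_edge_join_matching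
    by (simp add: edge_join_matching_simps)
qed

text \<open>
  On vectors constant on each factor the adjacency matrix acts by the matrix with rows \<open>(1, 2t)\<close> and
  \<open>(2, 1)\<close>; the eigenvector \<open>(-\<surd>t, 1)\<close> belongs to its smaller eigenvalue.
\<close>

lemma eigenvalue_adjacency_edge_join_matching:
  assumes "t \<ge> 1"
  shows "eigenvalue (adjacency_matrix (edge_join_matching t)) (1 - 2 * sqrt (real t))"
  unfolding eigenvalue_adjacency_iff[OF simple_graph_edge_join_matching]
proof (intro exI conjI)
  let ?x = "case_sum (\<lambda>_. - sqrt (real t)) (\<lambda>_. 1)"
  have "Inl 0 \<in> verts (edge_join_matching t)"
    by (simp add: edge_join_matching_def join_def verts_complete_graph_2 InlI)
  then show "\<exists>v\<in>verts (edge_join_matching t). ?x v \<noteq> 0"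
    using assms by (intro bexI[of _ "Inl 0"]) simp_all
  have "sqrt (real t) * sqrt (real t) = real t"
    by simp
  then show "\<forall>v\<in>verts (edge_join_matching t).
      neighbour_sum (edge_join_matching t) ?x v = (1 - 2 * sqrt (real t)) * ?x v"
    unfolding ball_verts_edge_join_matching
    by (simp add: edge_join_matching_simps algebra_simps)
qed

theorem proposition4p1:
  fixes t :: nat and G :: "(nat + nat \<times> nat) ugraph"
  assumes "t > 1"
    and "G = complete_graph 2 \<nabla> copies t (complete_graph 2)"
  shows "Q_exact G \<and> \<not> L_exact G \<and> \<not> A_exact G"
proof -
  have G: "G = edge_join_matching t"
    by (simp add: assms(2) edge_join_matching_def)
  have t: "t \<ge> 1" "real t > 1"
    using assms(1) by simp_all
  have n: "real (num_verts G) = 2 * real t + 2" and W: "real (num_edges G) = 5 * real t + 1"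
    and c: "real (mcut G) = 4 * real t"
    using num_verts_edge_join_matching num_edges_edge_join_matching mcut_edge_join_matching[OF t(1)]
    by (simp_all add: G)
  have carrier: "signless_laplacian G \<in> carrier_mat (num_verts G) (num_verts G)"
    "laplacian G \<in> carrier_mat (num_verts G) (num_verts G)"
    "adjacency_matrix G \<in> carrier_mat (num_verts G) (num_verts G)"
    unfolding signless_laplacian_def laplacian_def
    by (auto intro!: add_carrier_mat minus_carrier_mat simp: adjacency_matrix_def)
  note fin = carrier[THEN finite_eigenvalues]
  have "least_eigenvalue (signless_laplacian G) = 2"
    unfolding least_eigenvalue_def
    using eigenvalue_signless_edge_join_matching[OF t(1)]
      eigenvalue_signless_edge_join_matching_ge[OF t(1)]
    by (intro Min_eqI fin(1)) (auto simp: G)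
  then have "Q_exact G"
    using t by (simp add: Q_exact_def n W c field_simps)
  moreover have "\<not> L_exact G"
  proof -
    have "2 * real t + 2 \<le> greatest_eigenvalue (laplacian G)"
      unfolding greatest_eigenvalue_def
      using eigenvalue_laplacian_edge_join_matching by (intro Max_ge fin(2)) (simp add: G)
    moreover have "4 / (2 * real t + 2) * (4 * real t) < 2 * real t + 2"
    proof -
      \<comment> \<open>Clearing denominators turns the claim into \<open>4 (real t - 1)\<^sup>2 > 0\<close>.\<close>
      have "0 < (real t - 1)\<^sup>2"
        using t by simp
      then show ?thesis
        using t by (simp add: field_simps power2_eq_square)
    qed
    ultimately show ?thesis
      by (simp add: L_exact_def n c)
  qed
  moreover have "\<not> A_exact G"
  proof -
    have "least_eigenvalue (adjacency_matrix G) \<le> 1 - 2 * sqrt (real t)"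
      unfolding least_eigenvalue_def
      using eigenvalue_adjacency_edge_join_matching[OF t(1)] by (intro Min_le fin(3)) (simp add: G)
    moreover have "1 - 2 * sqrt (real t) < 2 / (2 * real t + 2) * (5 * real t + 1 - 2 * (4 * real t))"
    proof -
      define s where "s = sqrt (real t)"
      have s: "s > 1" "real t = s\<^sup>2"
        using t by (simp_all add: s_def)
      \<comment> \<open>This product is the difference of the two sides after clearing the denominator \<open>s\<^sup>2 + 1\<close>.\<close>
      have "0 < 2 * s * (s - 1)\<^sup>2"
        using s by simp
      then have "(1 - 2 * s) * (s\<^sup>2 + 1) < 1 - 3 * s\<^sup>2"
        by (simp add: algebra_simps power2_eq_square)
      moreover have "0 < s\<^sup>2 + 1"
        by (simp add: add_nonneg_pos)
      ultimately have "1 - 2 * s < (1 - 3 * s\<^sup>2) / (s\<^sup>2 + 1)"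
        by (simp add: pos_less_divide_eq)
      also have "\<dots> = 2 / (2 * s\<^sup>2 + 2) * (5 * s\<^sup>2 + 1 - 2 * (4 * s\<^sup>2))"
        using \<open>0 < s\<^sup>2 + 1\<close> by (simp add: divide_simps) (simp add: algebra_simps)
      finally show ?thesis
        by (simp add: s(2)[symmetric] s_def[symmetric])
    qed
    ultimately show ?thesis
      by (simp add: A_exact_def n W c)
  qed
  ultimately show ?thesis
    by blast
qed

end
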